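(* Let $K,L$ be constant real skew-symmetric $n\times n$ matrices, $S:\mathbb{R}^n\to\mathbb{R}$ smooth, $\Delta t,\Delta x>0$, and $r\ge1$. On each diamond, the diamond scheme for $K\mathbf{z}_t+L\mathbf{z}_x=\nabla S(\mathbf{z})$ based on the $r$-stage Gauss Runge--Kutta method with weights $b_1,\dots,b_r$ satisfies the discrete symplectic conservation law $$\frac1{\Delta t}\sum_{i=1}^r b_i\big(\omega_i^{\mathrm t}+\omega_{\mathrm r}^i-(\omega_\ell^i+\omega_i^{\mathrm b})\big)+\frac1{\Delta x}\sum_{i=1}^r b_i\big(\kappa_{\mathrm r}^i+\kappa_i^{\mathrm b}-(\kappa_i^{\mathrm t}+\kappa_\ell^i)\big)=0,$$ where, for each edge value $\mathbf{z}\in\{\mathbf z^{\mathrm t}_i,\mathbf z_{\mathrm r}^i,\mathbf z^{\mathrm b}_i,\mathbf z_\ell^i\}$, the correspondingly indexed two-forms are $\omega=\tfrac12\,d\mathbf{z}\wedge K\,d\mathbf{z}$ and $\kappa=\tfrac12\,d\mathbf{z}\wedge L\,d\mathbf{z}$.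
   Context: Diamond scheme on a single diamond (width $\Delta x$, height $\Delta t$): put $\tilde K=\frac1{\Delta t}K-\frac1{\Delta x}L$ and $\tilde L=\frac1{\Delta t}K+\frac1{\Delta x}L$. The diamond is mapped linearly to the unit square by $\tilde x=\frac{x}{\Delta x}+\frac{t}{\Delta t}$, $\tilde t=-\frac{x}{\Delta x}+\frac{t}{\Delta t}$. The edge values, all in $\mathbb R^n$, are: left edge $\mathbf z_\ell^i$ (lower-left edge of the diamond), bottom edge $\mathbf z^{\mathrm b}_i$ (lower-right edge), right edge $\mathbf z_{\mathrm r}^i$ (upper-right edge), top edge $\mathbf z^{\mathrm t}_i$ (upper-left edge), $i=1,\dots,r$. (The value at a point is the same in either coordinate system, $\tilde{\mathbf z}=\mathbf z$.) They satisfy, together with internal stages $\mathbf Z_i^j,\mathbf X_i^j,\mathbf T_i^j\in\mathbb R^n$, for all $i,j\in\{1,\dots,r\}$: $$\mathbf Z_i^j=\mathbf z_\ell^j+\sum_k a_{ik}\mathbf X_k^j,\quad \mathbf Z_i^j=\mathbf z^{\mathrm b}_i+\sum_k a_{jk}\mathbf T_i^k,\quad \nabla S(\mathbf Z_i^j)=\tilde K\mathbf T_i^j+\tilde L\mathbf X_i^j,$$ $$\mathbf z_{\mathrm r}^i=\mathbf z_\ell^i+\sum_k b_k\mathbf X_k^i,\quad \mathbf z^{\mathrm t}_i=\mathbf z^{\mathrm b}_i+\sum_k b_k\mathbf T_i^k .$$ Here $(A,b,c)$, $A=(a_{ij})$, is the $r$-stage Gauss (Gauss--Legendre collocation) Runge--Kutta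 method on $[0,1]$. Differential forms: the edge values and stages are regarded as smooth functions on an arbitrary manifold parametrizing a smooth family of solutions of these equations, and $d$ is the exterior derivative on that manifold (equivalently, the one-forms $d\mathbf z$, $d\mathbf Z$, $d\mathbf X$, $d\mathbf T$ satisfy the linearized equations). For vectors of one-forms $\alpha,\beta$ and a matrix $M$, $\alpha\wedge M\beta=\sum_{a,b}M_{ab}\,\alpha_a\wedge\beta_b$. *)

theory Defs
  imports "HOL-Analysis.Analysis" "HOL-Computational_Algebra.Polynomial"
begin

text \<open>On an open set, \<open>Ck_on\<close> is k-fold continuous differentiability: every directional
  derivative of f is (k - 1)-fold continuously differentiable.\<close>

primrec Ck_on :: "nat \<Rightarrow> 'a::euclidean_space set \<Rightarrow> ('a \<Rightarrow> 'b::euclidean_space) \<Rightarrow> bool" where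
  "Ck_on 0 S f \<longleftrightarrow> continuous_on S f"
| "Ck_on (Suc k) S f \<longleftrightarrow>
     (\<forall>x\<in>S. f differentiable (at x)) \<and> (\<forall>v. Ck_on k S (\<lambda>x. frechet_derivative f (at x) v))"

definition smooth_on :: "'a::euclidean_space set \<Rightarrow> ('a \<Rightarrow> 'b::euclidean_space) \<Rightarrow> bool" where
  "smooth_on S f \<longleftrightarrow> (\<forall>k. Ck_on k S f)"

definition gradient :: "(real^'n \<Rightarrow> real) \<Rightarrow> real^'n \<Rightarrow> real^'n" where
  "gradient S x = (\<chi> i. frechet_derivative S (at x) (axis i 1))"

text \<open>A chart is a pair \<open>(U, \<phi>)\<close> of its domain and its coordinate map into the model space
  \<open>'e\<close>, whose dimension is the dimension of the manifold.\<close>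

type_synonym ('m, 'e) chart = "'m set \<times> ('m \<Rightarrow> 'e)"

definition smooth_manifold :: "'m topology \<Rightarrow> ('m, 'e::euclidean_space) chart set \<Rightarrow> bool" where
  "smooth_manifold M \<A> \<longleftrightarrow>
     Hausdorff_space M \<and> second_countable M \<and>
     (\<Union>(U, \<phi>)\<in>\<A>. U) = topspace M \<and>
     (\<forall>(U, \<phi>)\<in>\<A>. openin M U \<and> open (\<phi> ` U) \<and>
        homeomorphic_map (subtopology M U) (top_of_set (\<phi> ` U)) \<phi>) \<and>
     (\<forall>(U, \<phi>)\<in>\<A>. \<forall>(V, \<psi>)\<in>\<A>. smooth_on (\<phi> ` (U \<inter> V)) (\<psi> \<circ> inv_into U \<phi>))"

definition smooth_map ::
  "('m, 'e::euclidean_space) chart set \<Rightarrow> ('m \<Rightarrow> 'b::euclidean_space) \<Rightarrow> bool" where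
  "smooth_map \<A> f \<longleftrightarrow> (\<forall>(U, \<phi>)\<in>\<A>. smooth_on (\<phi> ` U) (f \<circ> inv_into U \<phi>))"

text \<open>Tangent vectors at p are represented by their coordinates in a chart around p. The
  value of the one-form df at p on the tangent vector with coordinates u is the directional
  derivative of the coordinate expression of f.\<close>

definition ext_deriv ::
  "('m, 'e::euclidean_space) chart \<Rightarrow> 'm \<Rightarrow> ('m \<Rightarrow> real) \<Rightarrow> 'e \<Rightarrow> real" where
  "ext_deriv c p f u =
     (case c of (U, \<phi>) \<Rightarrow> frechet_derivative (f \<circ> inv_into U \<phi>) (at (\<phi> p)) u)"

definition vec_ext_deriv ::
  "('m, 'e::euclidean_space) chart \<Rightarrow> 'm \<Rightarrow> ('m \<Rightarrow> real^'n) \<Rightarrow> 'n \<Rightarrow> 'e \<Rightarrow> real" where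
  "vec_ext_deriv c p z a = ext_deriv c p (\<lambda>q. z q $ a)"

definition wedge :: "('e \<Rightarrow> real) \<Rightarrow> ('e \<Rightarrow> real) \<Rightarrow> 'e \<Rightarrow> 'e \<Rightarrow> real" where
  "wedge \<alpha> \<beta> u v = \<alpha> u * \<beta> v - \<alpha> v * \<beta> u"

definition mat_wedge ::
  "('n::finite \<Rightarrow> 'e \<Rightarrow> real) \<Rightarrow> real^'n^'n \<Rightarrow> ('n \<Rightarrow> 'e \<Rightarrow> real) \<Rightarrow> 'e \<Rightarrow> 'e \<Rightarrow> real" where
  "mat_wedge \<alpha> M \<beta> u v = (\<Sum>a\<in>UNIV. \<Sum>b\<in>UNIV. M $ a $ b * wedge (\<alpha> a) (\<beta> b) u v)"

text \<open>The two-form \<open>1/2 dz \<and> M dz\<close> at p.\<close>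

definition two_form ::
  "real^'n^'n \<Rightarrow> ('m, 'e::euclidean_space) chart \<Rightarrow> 'm \<Rightarrow> ('m \<Rightarrow> real^'n) \<Rightarrow> 'e \<Rightarrow> 'e \<Rightarrow> real" where
  "two_form M c p z u v = 1 / 2 * mat_wedge (vec_ext_deriv c p z) M (vec_ext_deriv c p z) u v"

text \<open>Up to a nonzero factor, the Legendre polynomial of degree r shifted to \<open>[0,1]\<close>,
  by the Rodrigues formula.\<close>

definition shifted_legendre :: "nat \<Rightarrow> real poly" where
  "shifted_legendre r = (pderiv ^^ r) (([:0, 1:] * [:-1, 1:]) ^ r)"

definition lagrange_basis :: "nat \<Rightarrow> (nat \<Rightarrow> real) \<Rightarrow> nat \<Rightarrow> real \<Rightarrow> real" where
  "lagrange_basis r c j x = (\<Prod>k\<in>{1..r} - {j}. (x - c k) / (c j - c k))"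

text \<open>Stages are numbered \<open>1, \<dots>, r\<close>. All r zeros of \<open>shifted_legendre r\<close> are simple and lie
  in the open unit interval, so the nodes are exactly these zeros, in any order.\<close>

definition gauss_RK ::
  "nat \<Rightarrow> (nat \<Rightarrow> nat \<Rightarrow> real) \<Rightarrow> (nat \<Rightarrow> real) \<Rightarrow> (nat \<Rightarrow> real) \<Rightarrow> bool" where
  "gauss_RK r a b c \<longleftrightarrow>
     inj_on c {1..r} \<and>
     (\<forall>i\<in>{1..r}. c i \<in> {0<..<1} \<and> poly (shifted_legendre r) (c i) = 0) \<and>
     (\<forall>i\<in>{1..r}. \<forall>j\<in>{1..r}. a i j = integral {0..c i} (lagrange_basis r c j)) \<and>
     (\<forall>j\<in>{1..r}. b j = integral {0..1} (lagrange_basis r c j))"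

definition K_tilde :: "real^'n^'n \<Rightarrow> real^'n^'n \<Rightarrow> real \<Rightarrow> real \<Rightarrow> real^'n^'n" where
  "K_tilde K L \<Delta>t \<Delta>x = (1 / \<Delta>t) *\<^sub>R K - (1 / \<Delta>x) *\<^sub>R L"

definition L_tilde :: "real^'n^'n \<Rightarrow> real^'n^'n \<Rightarrow> real \<Rightarrow> real \<Rightarrow> real^'n^'n" where
  "L_tilde K L \<Delta>t \<Delta>x = (1 / \<Delta>t) *\<^sub>R K + (1 / \<Delta>x) *\<^sub>R L"

text \<open>\<open>zl\<close>, \<open>zb\<close>, \<open>zr\<close>, \<open>zt\<close> are the values on the left (lower-left), bottom (lower-right),
  right (upper-right) and top (upper-left) edge of the diamond. In the stages \<open>Z i j\<close>,
  \<open>X i j\<close>, \<open>T i j\<close> the first argument is the subscript and the second the superscript.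
  The equations are those in the coordinates in which the diamond is the unit square.\<close>

definition diamond_scheme ::
  "nat \<Rightarrow> (nat \<Rightarrow> nat \<Rightarrow> real) \<Rightarrow> (nat \<Rightarrow> real) \<Rightarrow>
   real^'n^'n \<Rightarrow> real^'n^'n \<Rightarrow> (real^'n \<Rightarrow> real) \<Rightarrow> real \<Rightarrow> real \<Rightarrow>
   (nat \<Rightarrow> real^'n) \<Rightarrow> (nat \<Rightarrow> real^'n) \<Rightarrow> (nat \<Rightarrow> real^'n) \<Rightarrow> (nat \<Rightarrow> real^'n) \<Rightarrow>
   (nat \<Rightarrow> nat \<Rightarrow> real^'n) \<Rightarrow> (nat \<Rightarrow> nat \<Rightarrow> real^'n) \<Rightarrow> (nat \<Rightarrow> nat \<Rightarrow> real^'n) \<Rightarrow> bool" where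
  "diamond_scheme r a b K L S \<Delta>t \<Delta>x zl zb zr zt Z X T \<longleftrightarrow>
     (\<forall>i\<in>{1..r}. \<forall>j\<in>{1..r}.
        Z i j = zl j + (\<Sum>k=1..r. a i k *\<^sub>R X k j) \<and>
        Z i j = zb i + (\<Sum>k=1..r. a j k *\<^sub>R T i k) \<and>
        gradient S (Z i j) = K_tilde K L \<Delta>t \<Delta>x *v T i j + L_tilde K L \<Delta>t \<Delta>x *v X i j) \<and>
     (\<forall>i\<in>{1..r}.
        zr i = zl i + (\<Sum>k=1..r. b k *\<^sub>R X k i) \<and>
        zt i = zb i + (\<Sum>k=1..r. b k *\<^sub>R T i k))"

end

theory Submission
  imports Defs
begin

text \<open>In the coordinates of the unit square the scheme applies the Gauss method separately in the
  two directions. Its coefficients satisfy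
  \<open>b i * a i j + b j * a j i = b i * b j\<close>: apply Gauss quadrature, which is exact up to degree
  2r - 1, to the derivative of the product of the primitives of two Lagrange polynomials. Hence
  for every bilinear form B the increment of \<open>B dz dz\<close> across the diamond is a weighted sum of
  \<open>B dZ dX + B dX dZ\<close> over the stages. Taking B from the skew matrices \<open>L_tilde\<close> and
  \<open>K_tilde\<close> in the respective directions and adding, each stage contributes
  \<open>dZ \<and> (K_tilde dT + L_tilde dX) = dZ \<and> S''(Z) dZ\<close>, which vanishes because the Hessian is
  symmetric.\<close>

subsection \<open>Gauss quadrature\<close>

lemma integral_poly_pderiv:
  fixes P :: "real poly"
  assumes "x \<le> y"
  shows "integral {x..y} (poly (pderiv P)) = poly P y - poly P x"
  by (rule integral_unique, rule fundamental_theorem_of_calculus[OF assms])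
    (auto simp: has_real_derivative_iff_has_vector_derivative[symmetric]
      intro: has_field_derivative_at_within poly_DERIV)

lemma integrable_poly: "poly (p :: real poly) integrable_on {x..y}"
  by (intro integrable_continuous_interval continuous_intros)

lemma integral_poly_add:
  fixes p q :: "real poly"
  shows "integral {x..y} (poly (p + q)) = integral {x..y} (poly p) + integral {x..y} (poly q)"
  using integral_add[OF integrable_poly integrable_poly, of x y p q] by (simp flip: poly_add)

lemma integral_poly_diff:
  fixes p q :: "real poly"
  shows "integral {x..y} (poly (p - q)) = integral {x..y} (poly p) - integral {x..y} (poly q)"
  using integral_diff[OF integrable_poly integrable_poly, of x y p q] by (simp flip: poly_diff)

text \<open>With the primitive normalised at 0, its value at a node is the integral from 0 to that
  node, the form in which the Runge--Kutta coefficients are given. The degree bound later keeps a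
  product of two primitives within the range of exact quadrature.\<close>

lemma ex_poly_primitive:
  fixes p :: "real poly"
  obtains P where "pderiv P = p" "degree P \<le> Suc (degree p)" "poly P 0 = 0"
proof
  define P where "P = (\<Sum>i\<le>degree p. monom (coeff p i / real (Suc i)) (Suc i))"
  have "pderiv P = (\<Sum>i\<le>degree p. monom (coeff p i) i)"
    using higher_pderiv_sum[of 1 "\<lambda>i. monom (coeff p i / real (Suc i)) (Suc i)" "{..degree p}"]
    by (simp add: P_def pderiv_monom del: of_nat_Suc)
  then show "pderiv P = p"
    by (simp add: poly_as_sum_of_monoms)
  show "degree P \<le> Suc (degree p)"
    unfolding P_def by (rule degree_sum_le) (auto intro: order.trans[OF degree_monom_le])
  show "poly P 0 = 0"
    by (simp add: P_def poly_sum poly_monom)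
qed

section \<open>Orthogonality of the shifted Legendre polynomials\<close>

lemma power_dvd_pderiv:
  fixes p g :: "real poly"
  assumes "p ^ Suc n dvd g"
  shows "p ^ n dvd pderiv g"
proof -
  obtain h where "g = p ^ Suc n * h"
    using assms by (elim dvdE)
  then have "pderiv g = p ^ n * (p * pderiv h + smult (of_nat (Suc n)) (h * pderiv p))"
    by (simp only: pderiv_mult pderiv_power_Suc) (simp add: algebra_simps)
  then show ?thesis
    by simp
qed

text \<open>By the product rule, each differentiation costs at most one factor
  \<open>p\<close>.\<close>

lemma power_dvd_higher_pderiv:
  fixes p g :: "real poly"
  assumes "p ^ n dvd g" "k \<le> n"
  shows "p ^ (n - k) dvd (pderiv ^^ k) g"
  using assms(2)
proof (induction k)
  case 0
  then show ?case using assms(1) by simp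
next
  case (Suc k)
  then have "p ^ Suc (n - Suc k) dvd (pderiv ^^ k) g"
    by (simp add: Suc_diff_Suc)
  then show ?case
    by (simp only: funpow.simps o_apply power_dvd_pderiv)
qed

lemma poly_higher_pderiv_eq_0:
  fixes g :: "real poly"
  assumes "p ^ n dvd g" "k < n" "poly p x = 0"
  shows "poly ((pderiv ^^ k) g) x = 0"
proof -
  obtain h where "(pderiv ^^ k) g = p ^ (n - k) * h"
    using power_dvd_higher_pderiv[OF assms(1), of k] assms(2) by (auto elim: dvdE)
  then show ?thesis
    using assms(2,3) by simp
qed

text \<open>Integration by parts \<open>m\<close> times: all boundary terms vanish, and
  \<open>q\<close> is differentiated away. The zero polynomial has degree 0, so the disjunct
  \<open>q = 0\<close> has to be explicit; for \<open>m = 0\<close> it is the only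
  possibility.\<close>

lemma integral_mult_higher_pderiv_eq_0:
  fixes g q :: "real poly"
  assumes "x \<le> y"
    and "\<And>k. k < m \<Longrightarrow> poly ((pderiv ^^ k) g) x = 0"
    and "\<And>k. k < m \<Longrightarrow> poly ((pderiv ^^ k) g) y = 0"
    and "q = 0 \<or> degree q < m"
  shows "integral {x..y} (poly (q * (pderiv ^^ m) g)) = 0"
  using assms(2-)
proof (induction m arbitrary: q)
  case 0
  then show ?case by simp
next
  case (Suc m)
  let ?D = "(pderiv ^^ m) g"
  have eq: "q * (pderiv ^^ Suc m) g = pderiv (q * ?D) - pderiv q * ?D"
    by (simp add: pderiv_mult algebra_simps)
  have "integral {x..y} (poly (q * (pderiv ^^ Suc m) g))
      = integral {x..y} (poly (pderiv (q * ?D))) - integral {x..y} (poly (pderiv q * ?D))"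
    unfolding eq by (rule integral_poly_diff)
  also have "integral {x..y} (poly (pderiv (q * ?D))) = 0"
    using Suc.prems(1,2)[of m] assms(1) by (simp only: integral_poly_pderiv) simp
  \<comment> \<open>If \<open>q\<close> is constant, \<open>pderiv q\<close> is 0; otherwise its
    degree is one lower, so the induction hypothesis applies in both cases.\<close>
  also have "integral {x..y} (poly (pderiv q * ?D)) = 0"
    using Suc.prems
    by (intro Suc.IH) (auto simp: pderiv_eq_0_iff degree_pderiv)
  finally show ?case by simp
qed

lemma degree_shifted_legendre: "degree (shifted_legendre r) = r"
  by (simp add: shifted_legendre_def degree_higher_pderiv degree_power_eq)

text \<open>The polynomial differentiated in the Rodrigues formula has zeros of order
  \<open>r\<close> at 0 and 1, so its derivatives below order \<open>r\<close> vanish at both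
  ends.\<close>

lemma shifted_legendre_orthogonal:
  assumes "q = 0 \<or> degree q < r"
  shows "integral {0..1} (poly (q * shifted_legendre r)) = 0"
  unfolding shifted_legendre_def
  by (intro integral_mult_higher_pderiv_eq_0 poly_higher_pderiv_eq_0[OF dvd_refl] assms) auto

section \<open>Lagrange interpolation with polynomials as algebraic objects\<close>

definition lagrange_poly :: "nat \<Rightarrow> (nat \<Rightarrow> real) \<Rightarrow> nat \<Rightarrow> real poly" where
  "lagrange_poly r c j = (\<Prod>k\<in>{1..r} - {j}. smult (1 / (c j - c k)) [:- c k, 1:])"

lemma poly_lagrange_poly: "poly (lagrange_poly r c j) = lagrange_basis r c j"
  by (rule ext) (simp add: lagrange_poly_def lagrange_basis_def poly_prod diff_divide_distrib)

lemma degree_lagrange_poly: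
  assumes "j \<in> {1..r}"
  shows "degree (lagrange_poly r c j) < r"
proof -
  have "degree (lagrange_poly r c j) \<le> (\<Sum>k\<in>{1..r} - {j}. degree (smult (1 / (c j - c k)) [:- c k, 1:]))"
    unfolding lagrange_poly_def by (rule order.trans[OF degree_prod_sum_le])
      (simp_all only: o_def finite_Diff finite_atLeastAtMost order.refl)
  also have "\<dots> \<le> (\<Sum>k\<in>{1..r} - {j}. 1)"
    by (intro sum_mono) simp
  also have "\<dots> < r"
    using assms by (simp add: card_Diff_singleton)
  finally show ?thesis .
qed

lemma lagrange_basis_node:
  assumes "inj_on c {1..r}" "i \<in> {1..r}" "j \<in> {1..r}"
  shows "lagrange_basis r c j (c i) = (if i = j then 1 else 0)"
proof (cases "i = j")
  case True
  have "c j - c k \<noteq> 0" if "k \<in> {1..r} - {j}" for k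
    using inj_onD[OF assms(1), of j k] assms(3) that by auto
  then show ?thesis
    using True by (simp add: lagrange_basis_def)
next
  case False
  then show ?thesis
    using assms(2) by (auto simp: lagrange_basis_def intro: prod_zero)
qed

text \<open>Both sides have degree below \<open>r\<close> and agree at \<open>r\<close> distinct
  nodes.\<close>

lemma lagrange_interpolation:
  assumes "inj_on c {1..r}" "degree p < r"
  shows "p = (\<Sum>j=1..r. smult (poly p (c j)) (lagrange_poly r c j))"
proof (rule poly_eqI_degree[where A = "c ` {1..r}"])
  fix x assume "x \<in> c ` {1..r}"
  then obtain i where i: "i \<in> {1..r}" "x = c i" by auto
  have "poly (\<Sum>j=1..r. smult (poly p (c j)) (lagrange_poly r c j)) x
      = (\<Sum>j=1..r. poly p (c j) * lagrange_basis r c j (c i))"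
    by (simp add: poly_sum poly_lagrange_poly i)
  also have "\<dots> = (\<Sum>j=1..r. if i = j then poly p (c j) else 0)"
    by (intro sum.cong refl) (use i in \<open>simp add: lagrange_basis_node[OF assms(1)]\<close>)
  finally show "poly p x = poly (\<Sum>j=1..r. smult (poly p (c j)) (lagrange_poly r c j)) x"
    using i by simp
next
  show "degree p < card (c ` {1..r})"
    using assms by (simp add: card_image)
  show "degree (\<Sum>j=1..r. smult (poly p (c j)) (lagrange_poly r c j)) < card (c ` {1..r})"
    using assms by (intro degree_sum_less)
      (auto simp: card_image intro: le_less_trans[OF degree_smult_le] degree_lagrange_poly)
qed

text \<open>Divide \<open>f\<close> by the shifted Legendre polynomial. The multiple of that
  polynomial integrates to 0 by orthogonality and vanishes at the nodes; the remainder is integrated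
  exactly because it equals its interpolant.\<close>

lemma gauss_quadrature_exact:
  assumes gauss: "gauss_RK r a b c" and deg: "degree f < 2 * r"
  shows "integral {0..1} (poly f) = (\<Sum>k=1..r. b k * poly f (c k))"
proof -
  let ?L = "shifted_legendre r"
  define q where "q = f div ?L"
  define s where "s = f mod ?L"
  have r: "r > 0" using deg by simp
  have inj: "inj_on c {1..r}"
    and root: "\<And>k. k \<in> {1..r} \<Longrightarrow> poly ?L (c k) = 0"
    and b: "\<And>j. j \<in> {1..r} \<Longrightarrow> b j = integral {0..1} (lagrange_basis r c j)"
    using gauss by (auto simp: gauss_RK_def)
  have L0: "?L \<noteq> 0" using degree_shifted_legendre[of r] r by auto
  have s: "degree s < r"
    using degree_mod_less'[OF L0, of f] r by (cases "s = 0") (auto simp: s_def degree_shifted_legendre)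
  have f: "f = q * ?L + s" by (simp add: q_def s_def)
  have q: "q = 0 \<or> degree q < r"
  proof (cases "q = 0")
    case False
    \<comment> \<open>Here \<open>f - s\<close> is the product of two nonzero polynomials, so the
      degrees add.\<close>
    have "degree q + r = degree (f - s)"
      using degree_mult_eq[OF False L0] by (simp add: f degree_shifted_legendre)
    also have "\<dots> < 2 * r"
      using deg s by (intro degree_diff_less) auto
    finally show ?thesis by simp
  qed simp
  have "integral {0..1} (poly f) = integral {0..1} (poly (q * ?L)) + integral {0..1} (poly s)"
    by (subst f) (rule integral_poly_add)
  also have "\<dots> = integral {0..1} (poly s)"
    by (simp only: shifted_legendre_orthogonal[OF q])
  also have "\<dots> = integral {0..1} (\<lambda>x. \<Sum>j=1..r. poly s (c j) * poly (lagrange_poly r c j) x)"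
    by (rule arg_cong[where f = "integral {0..1}"], rule ext, subst lagrange_interpolation[OF inj s])
      (simp add: poly_sum)
  also have "\<dots> = (\<Sum>j=1..r. poly s (c j) * integral {0..1} (poly (lagrange_poly r c j)))"
    by (subst integral_sum) (auto intro!: integrable_on_mult_right integrable_poly)
  also have "\<dots> = (\<Sum>k=1..r. b k * poly s (c k))"
    by (intro sum.cong) (auto simp: b poly_lagrange_poly)
  also have "\<dots> = (\<Sum>k=1..r. b k * poly f (c k))"
    by (intro sum.cong) (auto simp: f root)
  finally show ?thesis .
qed

text \<open>This is the algebraic condition under which a Runge--Kutta method conserves quadratic
  invariants.\<close>

lemma gauss_RK_symplectic:
  assumes gauss: "gauss_RK r a b c" and ij: "i \<in> {1..r}" "j \<in> {1..r}"
  shows "b i * a i j + b j * a j i = b i * b j"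
proof -
  have inj: "inj_on c {1..r}"
    and c: "\<And>k. k \<in> {1..r} \<Longrightarrow> c k \<in> {0<..<1}"
    and a: "\<And>k l. k \<in> {1..r} \<Longrightarrow> l \<in> {1..r} \<Longrightarrow> a k l = integral {0..c k} (lagrange_basis r c l)"
    and b: "\<And>l. l \<in> {1..r} \<Longrightarrow> b l = integral {0..1} (lagrange_basis r c l)"
    using gauss by (auto simp: gauss_RK_def)
  obtain P where P: "pderiv P = lagrange_poly r c i" "degree P \<le> Suc (degree (lagrange_poly r c i))"
    "poly P 0 = 0" by (rule ex_poly_primitive)
  obtain Q where Q: "pderiv Q = lagrange_poly r c j" "degree Q \<le> Suc (degree (lagrange_poly r c j))"
    "poly Q 0 = 0" by (rule ex_poly_primitive)
  \<comment> \<open>Collocation coefficients are values of the primitives at the nodes; in the same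
    way the weights are their values at 1.\<close>
  have aP: "a k i = poly P (c k)" and aQ: "a k j = poly Q (c k)" if "k \<in> {1..r}" for k
    using c[OF that] ij a[OF that] P(3) Q(3)
      integral_poly_pderiv[of 0 "c k" P] integral_poly_pderiv[of 0 "c k" Q]
    by (auto simp: P(1) Q(1) poly_lagrange_poly)
  have bP: "b i = poly P 1" and bQ: "b j = poly Q 1"
    using ij b P(3) Q(3) integral_poly_pderiv[of 0 1 P] integral_poly_pderiv[of 0 1 Q]
    by (auto simp: P(1) Q(1) poly_lagrange_poly)
  have "degree P \<le> r" "degree Q \<le> r"
    using P(2) Q(2) degree_lagrange_poly[OF ij(1), of c] degree_lagrange_poly[OF ij(2), of c] by linarith+
  then have "degree (pderiv (P * Q)) < 2 * r"
    using degree_mult_le[of P Q] ij by (simp add: degree_pderiv) linarith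
  from gauss_quadrature_exact[OF gauss this]
  have "b i * b j = (\<Sum>k=1..r. b k * poly (pderiv (P * Q)) (c k))"
    using P(3) by (simp add: integral_poly_pderiv bP bQ)
  \<comment> \<open>In the product rule, the derivatives of \<open>P\<close> and \<open>Q\<close>
    are Lagrange polynomials, which are Kronecker deltas at the nodes.\<close>
  also have "\<dots> = (\<Sum>k=1..r. (if k = j then b k * a k i else 0) + (if k = i then b k * a k j else 0))"
    using ij by (intro sum.cong refl) (simp add: pderiv_mult P(1) Q(1) poly_lagrange_poly
        aP[symmetric] aQ[symmetric] lagrange_basis_node[OF inj] distrib_left)
  also have "\<dots> = b i * a i j + b j * a j i"
    using ij by (simp add: sum.distrib)
  finally show ?thesis by simp
qed

subsection \<open>Symmetry of second derivatives\<close>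

lemma has_real_derivative_along_line:
  fixes f :: "'a::real_normed_vector \<Rightarrow> real"
  assumes "f differentiable at (x + t *\<^sub>R u)"
  shows "((\<lambda>t. f (x + t *\<^sub>R u)) has_real_derivative frechet_derivative f (at (x + t *\<^sub>R u)) u) (at t)"
proof -
  let ?D = "frechet_derivative f (at (x + t *\<^sub>R u))"
  have "((\<lambda>t. f (x + t *\<^sub>R u)) has_derivative (\<lambda>h. ?D (h *\<^sub>R u))) (at t)"
    using assms[unfolded frechet_derivative_works]
    by (rule has_derivative_compose[rotated]) (auto intro!: derivative_eq_intros)
  moreover have "?D (h *\<^sub>R u) = ?D u * h" for h
    using linear_cmul[OF linear_frechet_derivative[OF assms], of h u] by simp
  ultimately show ?thesis
    by (simp add: has_field_derivative_def)
qed

text \<open>The mean value theorem is applied twice: along \<open>v\<close> to the difference of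
  \<open>f\<close> over the step \<open>s\<close> in direction \<open>u\<close>, then along
  \<open>u\<close> to the derivative in direction \<open>v\<close>.\<close>

lemma second_difference_eq_second_derivative:
  fixes f :: "'a::real_normed_vector \<Rightarrow> real"
  assumes "\<And>x. f differentiable at x"
    and "\<And>x. (\<lambda>x. frechet_derivative f (at x) v) differentiable at x"
    and "s > 0"
  obtains \<sigma> \<tau> where "0 < \<sigma>" "\<sigma> < s" "0 < \<tau>" "\<tau> < s"
    "f (x + s *\<^sub>R u + s *\<^sub>R v) - f (x + s *\<^sub>R v) - f (x + s *\<^sub>R u) + f x
      = s * s * frechet_derivative (\<lambda>x. frechet_derivative f (at x) v) (at (x + \<tau> *\<^sub>R v + \<sigma> *\<^sub>R u)) u"
proof -
  let ?D = "\<lambda>x. frechet_derivative f (at x) v"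
  \<comment> \<open>The endpoint terms keep the shape \<open>0 *\<^sub>R v\<close>, so that they are
    instances of the function to which the mean value theorem is applied.\<close>
  have "\<exists>\<tau>>0. \<tau> < s \<and> (f (x + s *\<^sub>R u + s *\<^sub>R v) - f (x + s *\<^sub>R v)) - (f (x + s *\<^sub>R u + 0 *\<^sub>R v) - f (x + 0 *\<^sub>R v))
      = (s - 0) * (?D (x + s *\<^sub>R u + \<tau> *\<^sub>R v) - ?D (x + \<tau> *\<^sub>R v))"
    by (rule MVT2[OF assms(3)]) (intro DERIV_diff has_real_derivative_along_line assms)
  then obtain \<tau> where \<tau>: "0 < \<tau>" "\<tau> < s"
    "f (x + s *\<^sub>R u + s *\<^sub>R v) - f (x + s *\<^sub>R v) - f (x + s *\<^sub>R u) + f x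
      = s * (?D (x + \<tau> *\<^sub>R v + s *\<^sub>R u) - ?D (x + \<tau> *\<^sub>R v))"
    by (auto simp: algebra_simps)
  have "\<exists>\<sigma>>0. \<sigma> < s \<and> ?D (x + \<tau> *\<^sub>R v + s *\<^sub>R u) - ?D (x + \<tau> *\<^sub>R v + 0 *\<^sub>R u)
      = (s - 0) * frechet_derivative ?D (at (x + \<tau> *\<^sub>R v + \<sigma> *\<^sub>R u)) u"
    by (rule MVT2[OF assms(3)]) (intro has_real_derivative_along_line assms)
  then show ?thesis
    using \<tau> that by auto
qed

text \<open>The second difference is symmetric in \<open>u\<close> and \<open>v\<close>. Divided by
  the squared step, it converges to each of the two mixed derivatives, by their continuity.\<close>

lemma frechet_derivative_commute:
  fixes f :: "'a::euclidean_space \<Rightarrow> real"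
  assumes "Ck_on 2 UNIV f"
  shows "frechet_derivative (\<lambda>x. frechet_derivative f (at x) v) (at x) u
       = frechet_derivative (\<lambda>x. frechet_derivative f (at x) u) (at x) v"
proof -
  define D where "D = (\<lambda>u v x. frechet_derivative (\<lambda>x. frechet_derivative f (at x) v) (at x) u)"
  have diff: "\<And>x. f differentiable at x"
    "\<And>v x. (\<lambda>x. frechet_derivative f (at x) v) differentiable at x"
    and cont: "\<And>u v. continuous_on UNIV (D u v)"
    using assms by (auto simp: numeral_2_eq_2 D_def)
  define s where "s n = 1 / real (Suc n)" for n
  have s: "s n > 0" for n by (simp add: s_def)
  have s0: "s \<longlonglongrightarrow> 0"
    unfolding s_def using LIMSEQ_inverse_real_of_nat by (simp add: inverse_eq_divide)
  define \<Delta> where "\<Delta> n = f (x + s n *\<^sub>R u + s n *\<^sub>R v) - f (x + s n *\<^sub>R v) - f (x + s n *\<^sub>R u) + f x" for n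
  \<comment> \<open>Stated for arbitrary \<open>u\<close>, \<open>v\<close> and \<open>w\<close>, so
    that it can be used for \<open>\<Delta>\<close> with the two directions in either order.\<close>
  have lim: "(\<lambda>n. w n / (s n * s n)) \<longlonglongrightarrow> D u v x"
    if "\<And>n. w n = f (x + s n *\<^sub>R u + s n *\<^sub>R v) - f (x + s n *\<^sub>R v) - f (x + s n *\<^sub>R u) + f x" for u v w
  proof -
    have "\<exists>\<sigma> \<tau>. 0 < \<sigma> \<and> \<sigma> < s n \<and> 0 < \<tau> \<and> \<tau> < s n \<and>
       w n = s n * s n * D u v (x + \<tau> *\<^sub>R v + \<sigma> *\<^sub>R u)" for n
      using second_difference_eq_second_derivative[OF diff(1) diff(2)[of v] s[of n], where x = x and u = u] that[of n]
      unfolding D_def by metis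
    then obtain \<sigma> \<tau> where st: "\<And>n. 0 < \<sigma> n" "\<And>n. \<sigma> n < s n" "\<And>n. 0 < \<tau> n" "\<And>n. \<tau> n < s n"
      "\<And>n. w n = s n * s n * D u v (x + \<tau> n *\<^sub>R v + \<sigma> n *\<^sub>R u)"
      by metis
    have "\<eta> \<longlonglongrightarrow> 0" if "\<And>n. 0 < \<eta> n" "\<And>n. \<eta> n < s n" for \<eta>
      by (rule tendsto_sandwich[OF _ _ tendsto_const s0]) (use that in \<open>auto intro!: always_eventually less_imp_le\<close>)
    then have "\<sigma> \<longlonglongrightarrow> 0" "\<tau> \<longlonglongrightarrow> 0"
      using st by blast+
    then have "(\<lambda>n. x + \<tau> n *\<^sub>R v + \<sigma> n *\<^sub>R u) \<longlonglongrightarrow> x + 0 *\<^sub>R v + 0 *\<^sub>R u"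
      by (intro tendsto_intros)
    then have "(\<lambda>n. D u v (x + \<tau> n *\<^sub>R v + \<sigma> n *\<^sub>R u)) \<longlonglongrightarrow> D u v x"
      by (intro continuous_on_tendsto_compose[OF cont]) auto
    moreover have "w n / (s n * s n) = D u v (x + \<tau> n *\<^sub>R v + \<sigma> n *\<^sub>R u)" for n
      using s[of n] st(5)[of n] by simp
    ultimately show ?thesis by simp
  qed
  have "(\<lambda>n. \<Delta> n / (s n * s n)) \<longlonglongrightarrow> D u v x" "(\<lambda>n. \<Delta> n / (s n * s n)) \<longlonglongrightarrow> D v u x"
    by (rule lim; simp add: \<Delta>_def algebra_simps)+
  then show ?thesis
    unfolding D_def by (rule LIMSEQ_unique)
qed

section \<open>Gradient and Hessian of the potential\<close>

lemma frechet_derivative_eq_gradient_inner: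
  assumes "S differentiable at x"
  shows "frechet_derivative S (at x) w = gradient S x \<bullet> w"
proof -
  have "frechet_derivative S (at x) w = frechet_derivative S (at x) (\<Sum>i\<in>UNIV. w $ i *\<^sub>R axis i 1)"
    by (simp add: basis_expansion scalar_mult_eq_scaleR[symmetric])
  also have "\<dots> = (\<Sum>i\<in>UNIV. w $ i *\<^sub>R frechet_derivative S (at x) (axis i 1))"
    using linear_frechet_derivative[OF assms] by (simp add: linear_sum linear_cmul)
  finally show ?thesis
    by (simp add: gradient_def inner_vec_def mult.commute)
qed

lemma gradient_differentiable:
  assumes "Ck_on 2 UNIV S"
  shows "gradient S differentiable at x"
proof -
  have "(\<lambda>x. gradient S x $ i) differentiable at x" for i
    using assms by (simp add: gradient_def numeral_2_eq_2)
  then show ?thesis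
    by (subst differentiable_componentwise_within) (auto simp: Basis_vec_def inner_axis)
qed

text \<open>The inner product of the gradient with \<open>v\<close> is the directional derivative
  along \<open>v\<close>. Both sides are therefore mixed second derivatives of
  \<open>S\<close>.\<close>

lemma hessian_symmetric:
  assumes S: "Ck_on 2 UNIV S"
  shows "v \<bullet> frechet_derivative (gradient S) (at x) u = u \<bullet> frechet_derivative (gradient S) (at x) v"
proof -
  have "\<And>x. S differentiable at x"
    using S by (simp add: numeral_2_eq_2)
  then have D: "(\<lambda>x. frechet_derivative S (at x) v) = (\<lambda>x. v \<bullet> gradient S x)" for v
    by (simp add: frechet_derivative_eq_gradient_inner inner_commute)
  have "((\<lambda>x. v \<bullet> gradient S x) has_derivative (\<lambda>h. v \<bullet> frechet_derivative (gradient S) (at x) h)) (at x)" for v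
    using gradient_differentiable[OF S, of x] unfolding frechet_derivative_works
    by (rule has_derivative_inner_right)
  from frechet_derivative_at[OF this] frechet_derivative_commute[OF S, of v x u]
  show ?thesis by (simp add: D fun_eq_iff)
qed

subsection \<open>The linearized scheme\<close>

text \<open>Polarised form of the conservation of quadratic invariants. Expanding the increment
  leaves double sums with coefficients \<open>b i * b j\<close>. The symplecticity condition splits
  each into two parts, which complete \<open>z'\<close> to \<open>Z'\<close> and \<open>z\<close> to
  \<open>Z\<close>.\<close>

lemma RK_bilinear_form_increment:
  fixes B :: "'a::real_vector \<Rightarrow> 'a \<Rightarrow> real"
  assumes B: "bilinear B"
    and sympl: "\<And>i j. i \<in> {1..r} \<Longrightarrow> j \<in> {1..r} \<Longrightarrow> b i * a i j + b j * a j i = b i * b j"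
    and Z: "\<And>i. i \<in> {1..r} \<Longrightarrow> Z i = z + (\<Sum>k=1..r. a i k *\<^sub>R X k)"
    and Z': "\<And>i. i \<in> {1..r} \<Longrightarrow> Z' i = z' + (\<Sum>k=1..r. a i k *\<^sub>R X' k)"
  shows "B (z + (\<Sum>k=1..r. b k *\<^sub>R X k)) (z' + (\<Sum>k=1..r. b k *\<^sub>R X' k)) - B z z'
       = (\<Sum>k=1..r. b k * (B (Z k) (X' k) + B (X k) (Z' k)))"
proof -
  note bil = bilinear_ladd[OF B] bilinear_radd[OF B] bilinear_lmul[OF B] bilinear_rmul[OF B]
  have sum_left: "B (\<Sum>k=1..r. f k *\<^sub>R Y k) w = (\<Sum>k=1..r. f k * B (Y k) w)"
    and sum_right: "B w (\<Sum>k=1..r. f k *\<^sub>R Y k) = (\<Sum>k=1..r. f k * B w (Y k))" for f Y w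
    using B linear_sum[of "\<lambda>x. B x w" "\<lambda>k. f k *\<^sub>R Y k"] linear_sum[of "B w" "\<lambda>k. f k *\<^sub>R Y k"]
    by (simp_all add: bilinear_def bil)
  have sum_both: "B (\<Sum>k=1..r. b k *\<^sub>R X k) (\<Sum>k=1..r. b k *\<^sub>R X' k)
      = (\<Sum>i=1..r. \<Sum>j=1..r. (b i * b j) * B (X i) (X' j))"
    by (subst sum_left) (simp add: sum_right sum_distrib_left mult.assoc)
  have "B (z + (\<Sum>k=1..r. b k *\<^sub>R X k)) (z' + (\<Sum>k=1..r. b k *\<^sub>R X' k)) - B z z'
      = (\<Sum>k=1..r. b k * B z (X' k)) + (\<Sum>k=1..r. b k * B (X k) z')
        + (\<Sum>i=1..r. \<Sum>j=1..r. (b i * b j) * B (X i) (X' j))"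
    by (simp add: bil sum_both) (simp add: sum_left sum_right)
  also have "(\<Sum>i=1..r. \<Sum>j=1..r. (b i * b j) * B (X i) (X' j))
      = (\<Sum>i=1..r. \<Sum>j=1..r. (b i * a i j + b j * a j i) * B (X i) (X' j))"
    by (simp add: sympl)
  \<comment> \<open>Exchanging the summations in the second part moves the coefficient
    \<open>a i j\<close> onto the stage variable in the first argument of \<open>B\<close>.\<close>
  also have "\<dots> = (\<Sum>i=1..r. \<Sum>j=1..r. b i * a i j * B (X i) (X' j))
      + (\<Sum>i=1..r. \<Sum>j=1..r. b i * a i j * B (X j) (X' i))"
    by (simp add: distrib_right sum.distrib)
      (rule sum.swap)
  finally show ?thesis
    by (simp add: Z Z' bil sum_left sum_right sum_distrib_left sum.distrib algebra_simps)
qed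

section \<open>Skew-symmetric matrices as two-forms\<close>

definition matrix_form :: "real^'n^'n \<Rightarrow> real^'n \<Rightarrow> real^'n \<Rightarrow> real" where
  "matrix_form M x y = x \<bullet> (M *v y)"

lemma bilinear_matrix_form: "bilinear (matrix_form M)"
  by (auto simp: bilinear_def matrix_form_def matrix_vector_right_distrib inner_simps
      matrix_vector_mult_scaleR intro!: linearI)

lemma matrix_form_skew:
  assumes "transpose M = - M"
  shows "matrix_form M x y = - matrix_form M y x"
proof -
  have "matrix_form M x y = (transpose M *v x) \<bullet> y"
    by (simp add: matrix_form_def dot_lmul_matrix[symmetric])
  also have "\<dots> = - matrix_form M y x"
    by (simp add: assms matrix_form_def inner_commute vector_matrix_mult_def
        matrix_vector_mult_def sum_negf inner_vec_def)
  finally show ?thesis .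
qed

text \<open>The scalar one-forms of dz, evaluated at \<open>u\<close>, are gathered into one vector,
  so that the linearized equations become vector equations.\<close>

definition variation :: "('m, 'e::euclidean_space) chart \<Rightarrow> 'm \<Rightarrow> ('m \<Rightarrow> real^'n) \<Rightarrow> 'e \<Rightarrow> real^'n" where
  "variation C p z u = (\<chi> i. vec_ext_deriv C p z i u)"

text \<open>The wedge product antisymmetrises the bilinear form of \<open>M\<close>. For skew
  \<open>M\<close> this doubles it, which cancels the factor 1/2.\<close>

lemma two_form_eq_matrix_form:
  assumes "transpose M = - M"
  shows "two_form M C p z u v = matrix_form M (variation C p z u) (variation C p z v)"
proof -
  have "mat_wedge (vec_ext_deriv C p z) M (vec_ext_deriv C p z) u v
      = matrix_form M (variation C p z u) (variation C p z v)
        - matrix_form M (variation C p z v) (variation C p z u)"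
    by (simp add: mat_wedge_def wedge_def matrix_form_def variation_def inner_vec_def
        matrix_vector_mult_def sum_distrib_left right_diff_distrib sum_subtractf algebra_simps)
  then show ?thesis
    using matrix_form_skew[OF assms, of "variation C p z v" "variation C p z u"]
    by (simp add: two_form_def)
qed

text \<open>The equations for the variations along a single tangent vector. \<open>P\<close> and
  \<open>Q\<close> stand for \<open>K_tilde\<close> and \<open>L_tilde\<close>, and
  \<open>H i j\<close> for the Hessian at the stage \<open>Z i j\<close>. Two tangent vectors at the
  same point share \<open>H\<close>.\<close>

locale linearized_scheme =
  fixes r :: nat and a :: "nat \<Rightarrow> nat \<Rightarrow> real" and b :: "nat \<Rightarrow> real"
    and P Q :: "real^'n^'n" and H :: "nat \<Rightarrow> nat \<Rightarrow> real^'n \<Rightarrow> real^'n"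
    and zl zb zr zt :: "nat \<Rightarrow> real^'n" and Z X T :: "nat \<Rightarrow> nat \<Rightarrow> real^'n"
  assumes stage_X: "\<And>i j. i \<in> {1..r} \<Longrightarrow> j \<in> {1..r} \<Longrightarrow> Z i j = zl j + (\<Sum>k=1..r. a i k *\<^sub>R X k j)"
    and stage_T: "\<And>i j. i \<in> {1..r} \<Longrightarrow> j \<in> {1..r} \<Longrightarrow> Z i j = zb i + (\<Sum>k=1..r. a j k *\<^sub>R T i k)"
    and stage_H: "\<And>i j. i \<in> {1..r} \<Longrightarrow> j \<in> {1..r} \<Longrightarrow> H i j (Z i j) = P *v T i j + Q *v X i j"
    and right: "\<And>i. i \<in> {1..r} \<Longrightarrow> zr i = zl i + (\<Sum>k=1..r. b k *\<^sub>R X k i)"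
    and top: "\<And>i. i \<in> {1..r} \<Longrightarrow> zt i = zb i + (\<Sum>k=1..r. b k *\<^sub>R T i k)"

lemma linearized_scheme_conservation:
  assumes 1: "linearized_scheme r a b P Q H zl zb zr zt Z X T"
    and 2: "linearized_scheme r a b P Q H zl' zb' zr' zt' Z' X' T'"
    and sympl: "\<And>i j. i \<in> {1..r} \<Longrightarrow> j \<in> {1..r} \<Longrightarrow> b i * a i j + b j * a j i = b i * b j"
    and skew: "transpose P = - P" "transpose Q = - Q"
    and sym: "\<And>i j x y. i \<in> {1..r} \<Longrightarrow> j \<in> {1..r} \<Longrightarrow> x \<bullet> H i j y = y \<bullet> H i j x"
  shows "(\<Sum>i=1..r. b i * (matrix_form P (zt i) (zt' i) - matrix_form P (zb i) (zb' i)
            + (matrix_form Q (zr i) (zr' i) - matrix_form Q (zl i) (zl' i)))) = 0"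
proof -
  interpret L: linearized_scheme r a b P Q H zl zb zr zt Z X T by fact
  interpret L': linearized_scheme r a b P Q H zl' zb' zr' zt' Z' X' T' by fact
  let ?P = "\<lambda>i j. matrix_form P (Z i j) (T' i j) + matrix_form P (T i j) (Z' i j)"
  let ?Q = "\<lambda>i j. matrix_form Q (Z i j) (X' i j) + matrix_form Q (X i j) (Z' i j)"
  have T: "matrix_form P (zt i) (zt' i) - matrix_form P (zb i) (zb' i) = (\<Sum>j=1..r. b j * ?P i j)"
    if i: "i \<in> {1..r}" for i
    unfolding L.top[OF i] L'.top[OF i]
    using i by (intro RK_bilinear_form_increment[OF bilinear_matrix_form sympl] L.stage_T L'.stage_T)
  \<comment> \<open>From left to right the first stage index is summed and the second is fixed,
    hence the transposed \<open>?Q j i\<close>.\<close>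
  have X: "matrix_form Q (zr i) (zr' i) - matrix_form Q (zl i) (zl' i) = (\<Sum>j=1..r. b j * ?Q j i)"
    if i: "i \<in> {1..r}" for i
    unfolding L.right[OF i] L'.right[OF i]
    using i by (intro RK_bilinear_form_increment[OF bilinear_matrix_form sympl] L.stage_X L'.stage_X)
  have cancel: "?P i j + ?Q i j = 0" if ij: "i \<in> {1..r}" "j \<in> {1..r}" for i j
  proof -
    \<comment> \<open>Skewness moves \<open>Z'\<close> to the left in the terms with
      \<open>T\<close> and \<open>X\<close>. The remaining matrix products then group into the
      right-hand sides of the two stage equations.\<close>
    have "?P i j + ?Q i j = Z i j \<bullet> H i j (Z' i j) - Z' i j \<bullet> H i j (Z i j)"
      using matrix_form_skew[OF skew(1), of "T i j" "Z' i j"] matrix_form_skew[OF skew(2), of "X i j" "Z' i j"]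
      by (simp add: L.stage_H[OF ij] L'.stage_H[OF ij] inner_add_right matrix_form_def)
    then show ?thesis
      using sym[OF ij] by simp
  qed
  have "(\<Sum>i=1..r. b i * (matrix_form P (zt i) (zt' i) - matrix_form P (zb i) (zb' i)
            + (matrix_form Q (zr i) (zr' i) - matrix_form Q (zl i) (zl' i))))
      = (\<Sum>i=1..r. \<Sum>j=1..r. b i * b j * ?P i j) + (\<Sum>i=1..r. \<Sum>j=1..r. b i * b j * ?Q j i)"
    by (simp add: T X distrib_left sum.distrib sum_distrib_left mult.assoc)
  also have "(\<Sum>i=1..r. \<Sum>j=1..r. b i * b j * ?Q j i) = (\<Sum>i=1..r. \<Sum>j=1..r. b i * b j * ?Q i j)"
    by (subst sum.swap) (simp only: mult.commute)
  also have "(\<Sum>i=1..r. \<Sum>j=1..r. b i * b j * ?P i j) + \<dots>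
      = (\<Sum>i=1..r. \<Sum>j=1..r. b i * b j * (?P i j + ?Q i j))"
    by (simp only: distrib_left sum.distrib)
  also have "\<dots> = 0"
    by (simp only: cancel cong: sum.cong) simp
  finally show ?thesis .
qed

subsection \<open>Variations along tangent vectors\<close>

lemma smooth_manifold_chart:
  assumes "smooth_manifold M \<A>" "(U, \<phi>) \<in> \<A>"
  shows "open (\<phi> ` U)" "U \<subseteq> topspace M" "inj_on \<phi> U"
proof -
  have U: "openin M U" "open (\<phi> ` U)"
    "homeomorphic_map (subtopology M U) (top_of_set (\<phi> ` U)) \<phi>"
    using assms by (auto simp: smooth_manifold_def)
  then show "open (\<phi> ` U)" "U \<subseteq> topspace M"
    by (auto dest: openin_subset)
  then show "inj_on \<phi> U"
    using homeomorphic_imp_injective_map[OF U(3)] by (simp add: inf_absorb2)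
qed

text \<open>Uniqueness of the derivative, applied to each component.\<close>

lemma variation_eqI:
  assumes "((z \<circ> inv_into U \<phi>) has_derivative D) (at (\<phi> p))"
  shows "variation (U, \<phi>) p z u = D u"
proof -
  have "(((\<lambda>q. z q $ i) \<circ> inv_into U \<phi>) has_derivative (\<lambda>h. D h $ i)) (at (\<phi> p))" for i
    using bounded_linear.has_derivative[OF bounded_linear_vec_nth assms] by (simp add: o_def)
  from frechet_derivative_at[OF this] show ?thesis
    by (simp add: variation_def vec_ext_deriv_def ext_deriv_def vec_eq_iff fun_eq_iff)
qed

lemma smooth_map_has_derivative:
  assumes "smooth_map \<A> z" "(U, \<phi>) \<in> \<A>" "p \<in> U"
  shows "((z \<circ> inv_into U \<phi>) has_derivative variation (U, \<phi>) p z) (at (\<phi> p))"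
proof -
  have "Ck_on (Suc 0) (\<phi> ` U) (z \<circ> inv_into U \<phi>)"
    using assms unfolding smooth_map_def smooth_on_def by blast
  then have "(z \<circ> inv_into U \<phi>) differentiable at (\<phi> p)"
    using assms(3) by auto
  then obtain D where "((z \<circ> inv_into U \<phi>) has_derivative D) (at (\<phi> p))"
    by (auto simp: differentiable_def)
  with variation_eqI[OF this] show ?thesis
    by (metis ext)
qed

lemma variation_transfer:
  assumes "smooth_manifold M \<A>" "(U, \<phi>) \<in> \<A>" "p \<in> U"
    and "\<And>q. q \<in> U \<Longrightarrow> z q = w q"
    and "((w \<circ> inv_into U \<phi>) has_derivative D) (at (\<phi> p))"
  shows "variation (U, \<phi>) p z u = D u"
proof (rule variation_eqI)
  show "((z \<circ> inv_into U \<phi>) has_derivative D) (at (\<phi> p))"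
    using assms(5) smooth_manifold_chart(1)[OF assms(1,2)] imageI[OF assms(3)]
    by (rule has_derivative_transform_within_open) (auto simp: assms(4) inv_into_into)
qed

section \<open>Linear combinations of \<open>K\<close> and \<open>L\<close>, and linearization of
  the scheme\<close>

lemma transpose_lincomb: "transpose (s *\<^sub>R A + t *\<^sub>R B) = s *\<^sub>R transpose A + t *\<^sub>R transpose B"
  by (simp add: transpose_def vec_eq_iff)

lemma matrix_form_lincomb:
  "matrix_form (s *\<^sub>R A + t *\<^sub>R B) x y = s * matrix_form A x y + t * matrix_form B x y"
  by (simp add: matrix_form_def matrix_vector_mult_add_rdistrib inner_add_right
      flip: scaleR_matrix_vector_assoc)

lemma K_tilde_eq: "K_tilde K L \<Delta>t \<Delta>x = (1 / \<Delta>t) *\<^sub>R K + (- 1 / \<Delta>x) *\<^sub>R L"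
  by (simp add: K_tilde_def)

lemma linearized_scheme_variation:
  fixes K L :: "real^'n^'n"
    and \<A> :: "('m, 'e::euclidean_space) chart set"
    and zl zb zr zt :: "nat \<Rightarrow> 'm \<Rightarrow> real^'n"
  assumes S: "Ck_on 2 UNIV S"
    and M: "smooth_manifold M \<A>" and U: "(U, \<phi>) \<in> \<A>" and p: "p \<in> U"
    and edge: "\<And>i. i \<in> {1..r} \<Longrightarrow> smooth_map \<A> (zl i) \<and> smooth_map \<A> (zb i)"
    and stage: "\<And>i j. i \<in> {1..r} \<Longrightarrow> j \<in> {1..r} \<Longrightarrow>
           smooth_map \<A> (Z i j) \<and> smooth_map \<A> (X i j) \<and> smooth_map \<A> (T i j)"
    and scheme: "\<And>p. p \<in> topspace M \<Longrightarrow>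
           diamond_scheme r a b K L S \<Delta>t \<Delta>x
             (\<lambda>i. zl i p) (\<lambda>i. zb i p) (\<lambda>i. zr i p) (\<lambda>i. zt i p)
             (\<lambda>i j. Z i j p) (\<lambda>i j. X i j p) (\<lambda>i j. T i j p)"
  shows "linearized_scheme r a b (K_tilde K L \<Delta>t \<Delta>x) (L_tilde K L \<Delta>t \<Delta>x)
    (\<lambda>i j. frechet_derivative (gradient S) (at (Z i j p)))
    (\<lambda>i. variation (U, \<phi>) p (zl i) u) (\<lambda>i. variation (U, \<phi>) p (zb i) u)
    (\<lambda>i. variation (U, \<phi>) p (zr i) u) (\<lambda>i. variation (U, \<phi>) p (zt i) u)
    (\<lambda>i j. variation (U, \<phi>) p (Z i j) u) (\<lambda>i j. variation (U, \<phi>) p (X i j) u)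
    (\<lambda>i j. variation (U, \<phi>) p (T i j) u)"
proof -
  let ?d = "variation (U, \<phi>) p" and ?\<psi> = "inv_into U \<phi>"
  note D = smooth_map_has_derivative[OF _ U p, unfolded o_def]
  have scheme: "diamond_scheme r a b K L S \<Delta>t \<Delta>x
             (\<lambda>i. zl i q) (\<lambda>i. zb i q) (\<lambda>i. zr i q) (\<lambda>i. zt i q)
             (\<lambda>i j. Z i j q) (\<lambda>i j. X i j q) (\<lambda>i j. T i j q)" if "q \<in> U" for q
    using scheme smooth_manifold_chart(2)[OF M U] that by blast
  then have sX: "Z i j q = zl j q + (\<Sum>k=1..r. a i k *\<^sub>R X k j q)"
    and sT: "Z i j q = zb i q + (\<Sum>k=1..r. a j k *\<^sub>R T i k q)"
    and sH: "gradient S (Z i j q) = K_tilde K L \<Delta>t \<Delta>x *v T i j q + L_tilde K L \<Delta>t \<Delta>x *v X i j q"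
    and sr: "zr i q = zl i q + (\<Sum>k=1..r. b k *\<^sub>R X k i q)"
    and st: "zt i q = zb i q + (\<Sum>k=1..r. b k *\<^sub>R T i k q)"
    if "q \<in> U" "i \<in> {1..r}" "j \<in> {1..r}" for q i j
    using that unfolding diamond_scheme_def by blast+
  note eqI = variation_transfer[OF M U p, unfolded o_def]
  \<comment> \<open>The two stage relations and the two update relations all have this affine shape,
    so they are differentiated once and for all.\<close>
  have affine: "?d w u = ?d z u + (\<Sum>k=1..r. f k *\<^sub>R ?d (Y k) u)"
    if "\<And>q. q \<in> U \<Longrightarrow> w q = z q + (\<Sum>k=1..r. f k *\<^sub>R Y k q)" "smooth_map \<A> z"
      "\<And>k. k \<in> {1..r} \<Longrightarrow> smooth_map \<A> (Y k)" for w z Y and f :: "nat \<Rightarrow> real"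
    by (rule eqI[OF that(1)], assumption) (intro derivative_intros D that; assumption)
  show ?thesis
  proof
    fix i j assume ij: "i \<in> {1..r}" "j \<in> {1..r}"
    show "?d (Z i j) u = ?d (zl j) u + (\<Sum>k=1..r. a i k *\<^sub>R ?d (X k j) u)"
      by (rule affine[OF sX]) (use edge stage ij in auto)
    show "?d (Z i j) u = ?d (zb i) u + (\<Sum>k=1..r. a j k *\<^sub>R ?d (T i k) u)"
      by (rule affine[OF sT]) (use edge stage ij in auto)
    \<comment> \<open>This places the Hessian in the chain rule at \<open>Z i j p\<close>.\<close>
    have "?\<psi> (\<phi> p) = p"
      using smooth_manifold_chart(3)[OF M U] p by simp
    then have "((\<lambda>y. gradient S (Z i j (?\<psi> y))) has_derivative
        (\<lambda>h. frechet_derivative (gradient S) (at (Z i j p)) (?d (Z i j) h))) (at (\<phi> p))"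
      using has_derivative_compose[OF D[of "Z i j"]] stage[OF ij]
        gradient_differentiable[OF S, unfolded frechet_derivative_works] by metis
    then have "?d (\<lambda>q. gradient S (Z i j q)) u
        = frechet_derivative (gradient S) (at (Z i j p)) (?d (Z i j) u)"
      by (intro variation_eqI) (simp add: o_def)
    \<comment> \<open>The same variation is now computed from the right-hand side of the stage
      equation, which is linear in \<open>T\<close> and \<open>X\<close>; comparing the two results
      linearizes that equation.\<close>
    moreover have "?d (\<lambda>q. gradient S (Z i j q)) u
        = K_tilde K L \<Delta>t \<Delta>x *v ?d (T i j) u + L_tilde K L \<Delta>t \<Delta>x *v ?d (X i j) u"
    proof (rule eqI)
      show "gradient S (Z i j q) = K_tilde K L \<Delta>t \<Delta>x *v T i j q + L_tilde K L \<Delta>t \<Delta>x *v X i j q"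
        if "q \<in> U" for q
        using sH[OF that ij] .
      show "((\<lambda>y. K_tilde K L \<Delta>t \<Delta>x *v T i j (?\<psi> y) + L_tilde K L \<Delta>t \<Delta>x *v X i j (?\<psi> y)) has_derivative
        (\<lambda>u. K_tilde K L \<Delta>t \<Delta>x *v ?d (T i j) u + L_tilde K L \<Delta>t \<Delta>x *v ?d (X i j) u)) (at (\<phi> p))"
        using stage[OF ij]
        by (intro has_derivative_add bounded_linear.has_derivative[OF matrix_vector_mul_bounded_linear] D) auto
    qed
    ultimately show "frechet_derivative (gradient S) (at (Z i j p)) (?d (Z i j) u)
        = K_tilde K L \<Delta>t \<Delta>x *v ?d (T i j) u + L_tilde K L \<Delta>t \<Delta>x *v ?d (X i j) u"
      by simp
  next
    fix i assume i: "i \<in> {1..r}"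
    show "?d (zr i) u = ?d (zl i) u + (\<Sum>k=1..r. b k *\<^sub>R ?d (X k i) u)"
      by (rule affine[OF sr]) (use edge stage i in auto)
    show "?d (zt i) u = ?d (zb i) u + (\<Sum>k=1..r. b k *\<^sub>R ?d (T i k) u)"
      by (rule affine[OF st]) (use edge stage i in auto)
  qed
qed

theorem theorem4:
  fixes K L :: "real^'n^'n"
    and S :: "real^'n \<Rightarrow> real"
    and \<Delta>t \<Delta>x :: real
    and r :: nat
    and a :: "nat \<Rightarrow> nat \<Rightarrow> real"
    and b c :: "nat \<Rightarrow> real"
    and M :: "'m topology"
    and \<A> :: "('m, 'e::euclidean_space) chart set"
    and zl zb zr zt :: "nat \<Rightarrow> 'm \<Rightarrow> real^'n"
    and Z X T :: "nat \<Rightarrow> nat \<Rightarrow> 'm \<Rightarrow> real^'n"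
  assumes "transpose K = - K" and "transpose L = - L"
    and "smooth_on UNIV S"
    and "\<Delta>t > 0" and "\<Delta>x > 0"
    and "r \<ge> 1"
    and "gauss_RK r a b c"
    and "smooth_manifold M \<A>"
    and "\<And>i. i \<in> {1..r} \<Longrightarrow>
           smooth_map \<A> (zl i) \<and> smooth_map \<A> (zb i) \<and> smooth_map \<A> (zr i) \<and> smooth_map \<A> (zt i)"
    and "\<And>i j. i \<in> {1..r} \<Longrightarrow> j \<in> {1..r} \<Longrightarrow>
           smooth_map \<A> (Z i j) \<and> smooth_map \<A> (X i j) \<and> smooth_map \<A> (T i j)"
    and "\<And>p. p \<in> topspace M \<Longrightarrow>
           diamond_scheme r a b K L S \<Delta>t \<Delta>x
             (\<lambda>i. zl i p) (\<lambda>i. zb i p) (\<lambda>i. zr i p) (\<lambda>i. zt i p)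
             (\<lambda>i j. Z i j p) (\<lambda>i j. X i j p) (\<lambda>i j. T i j p)"
  shows "\<forall>(U, \<phi>)\<in>\<A>. \<forall>p\<in>U. \<forall>u v.
           (let \<omega> = (\<lambda>z. two_form K (U, \<phi>) p z u v);
                \<kappa> = (\<lambda>z. two_form L (U, \<phi>) p z u v)
            in 1 / \<Delta>t * (\<Sum>i=1..r. b i * (\<omega> (zt i) + \<omega> (zr i) - (\<omega> (zl i) + \<omega> (zb i)))) +
               1 / \<Delta>x * (\<Sum>i=1..r. b i * (\<kappa> (zr i) + \<kappa> (zb i) - (\<kappa> (zt i) + \<kappa> (zl i)))) = 0)"
proof (safe, unfold Let_def)
  fix U \<phi> p u v
  assume U: "(U, \<phi>) \<in> \<A>" and p: "p \<in> U"
  let ?C = "(U, \<phi>)" and ?P = "K_tilde K L \<Delta>t \<Delta>x" and ?Q = "L_tilde K L \<Delta>t \<Delta>x"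
  let ?B = "\<lambda>N z. matrix_form N (variation ?C p z u) (variation ?C p z v)"
  have S: "Ck_on 2 UNIV S"
    using assms(3) by (simp add: smooth_on_def)
  \<comment> \<open>The tangent vector is generalised here, so that the fact serves for both
    \<open>u\<close> and \<open>v\<close>.\<close>
  have lin: "linearized_scheme r a b ?P ?Q
    (\<lambda>i j. frechet_derivative (gradient S) (at (Z i j p)))
    (\<lambda>i. variation ?C p (zl i) u) (\<lambda>i. variation ?C p (zb i) u)
    (\<lambda>i. variation ?C p (zr i) u) (\<lambda>i. variation ?C p (zt i) u)
    (\<lambda>i j. variation ?C p (Z i j) u) (\<lambda>i j. variation ?C p (X i j) u)
    (\<lambda>i j. variation ?C p (T i j) u)" for u
    using assms(9) by (intro linearized_scheme_variation[OF S assms(8) U p _ assms(10,11)]) auto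
  have skew: "transpose ?P = - ?P" "transpose ?Q = - ?Q"
    by (simp_all only: K_tilde_eq L_tilde_def transpose_lincomb assms(1,2)) simp_all
  have "(\<Sum>i=1..r. b i * (?B ?P (zt i) - ?B ?P (zb i) + (?B ?Q (zr i) - ?B ?Q (zl i)))) = 0"
    by (rule linearized_scheme_conservation[OF lin lin gauss_RK_symplectic[OF assms(7)] skew
          hessian_symmetric[OF S]])
  \<comment> \<open>Splitting \<open>?P\<close> and \<open>?Q\<close> into \<open>K\<close> and
    \<open>L\<close>, the \<open>K\<close> terms of both directions enter with factor
    \<open>1 / \<Delta>t\<close>. The \<open>L\<close> terms carry \<open>- 1 / \<Delta>x\<close>
    for top minus bottom and \<open>1 / \<Delta>x\<close> for right minus left. The two sums then
    agree summand by summand.\<close>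
  then show "1 / \<Delta>t * (\<Sum>i=1..r. b i * (two_form K ?C p (zt i) u v + two_form K ?C p (zr i) u v
        - (two_form K ?C p (zl i) u v + two_form K ?C p (zb i) u v)))
      + 1 / \<Delta>x * (\<Sum>i=1..r. b i * (two_form L ?C p (zr i) u v + two_form L ?C p (zb i) u v
        - (two_form L ?C p (zt i) u v + two_form L ?C p (zl i) u v))) = 0"
    unfolding sum_distrib_left sum.distrib[symmetric] K_tilde_eq L_tilde_def matrix_form_lincomb
      two_form_eq_matrix_form[OF assms(1)] two_form_eq_matrix_form[OF assms(2)]
    by (rule trans[OF sum.cong[OF refl], rotated]) (simp add: algebra_simps)
qed

end
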